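(* Let $\mathbb{F}$ be a field, $d\ge3$, $V$ a vector space over $\mathbb{F}$ of dimension $d+1$, and $\Phi=(A;\{E_i\}_{i=0}^d;A^*;\{E^*_i\}_{i=0}^d)$ a CH system on $V$ with eigenvalue sequence $\{\theta_i\}_{i=0}^d$, dual eigenvalue sequence $\{\theta^*_i\}_{i=0}^d$ and $\Phi$-split sequence $\{\phi_i\}_{i=1}^d$. Fix nonzero vectors $u^*\in E^*_0V$ and $u\in E_0V$, and let $\varepsilon^*\in\mathbb{F}$ be the scalar with $E^*_0u=\varepsilon^*u^*$. For $0\le i\le d$ let $v_i=(A-\theta_{d-i+1}I)\cdots(A-\theta_{d-1}I)(A-\theta_dI)u^*$ and $v^*_i=(A^*-\theta^*_{d-i+1}I)\cdots(A^*-\theta^*_{d-1}I)(A^*-\theta^*_dI)u$. Then the transition matrix from the basis $\{v_{d-i}\}_{i=0}^d$ to the basis $\{v^*_i\}_{i=0}^d$ of $V$ is diagonal with $(i,i)$-entry $$\frac{\varepsilon^*(\theta^*_0-\theta^*_1)(\theta^*_0-\theta^*_2)\cdots(\theta^*_0-\theta^*_d)}{\phi_1\phi_2\cdots\phi_{d-i}}$$ for $0\le i\le d$. Moreover, the transition matrix from $\{v^*_i\}_{i=0}^d$ to $\{v_{d-i}\}_{i=0}^d$ is diagonal with $(i,i)$-entry $$\frac{\phi_1\phi_2\cdots\phi_{d-i}}{\varepsilon^*(\theta^*_0-\theta^*_1)(\theta^*_0-\theta^*_2)\cdots(\theta^*_0-\theta^*_d)}$$ for $0\le i\le d$.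
   Context: Rows and columns of $(d+1)\times(d+1)$ matrices are indexed by $0,\dots,d$. A matrix $M$ represents $B\in\mathrm{End}(V)$ with respect to a basis $\{w_i\}_{i=0}^d$ if $Bw_j=\sum_iM_{ij}w_i$. An element of $\mathrm{End}(V)$ is multiplicity-free if it is diagonalizable with all eigenspaces of dimension one. The primitive idempotent of a multiplicity-free $B$ for an eigenvalue $\theta$ is the $E\in\mathrm{End}(V)$ acting as the identity on the $\theta$-eigenspace and as $0$ on the other eigenspaces. A CH system on $V$ is a sequence $\Phi=(A;\{E_i\}_{i=0}^d;A^*;\{E^*_i\}_{i=0}^d)$ in $\mathrm{End}(V)$ such that: (i) $A,A^*$ are multiplicity-free; (ii) $\{E_i\}$ is an ordering of the primitive idempotents of $A$; (iii) $\{E^*_i\}$ is an ordering of the primitive idempotents of $A^*$; (iv) $E_iA^*E_j=0$ if $1<i-j$ or $1<j-i<d$, and $E_iA^*E_j\neq0$ if $i-j=1$ or $j-i=d$; (v) $E^*_iAE^*_j=0$ if $1<i-j$ or $1<j-i<d$, and $E^*_iAE^*_j\neq0$ if $i-j=1$ or $j-i=d$ $(0\le i,j\le d)$. $\theta_i$ (resp. $\theta^*_i$) is the eigenvalue of $A$ (resp. $A^*$) corresponding to $E_i$ (resp. $E^*_i$). It is known that there is a unique sequence $\{\phi_i\}_{i=1}^d$ of nonzero scalars (the $\Phi$-split sequence) such that for some basis of $V$, $A$ is represented by the lower bidiagonal matrix with $(i,i)$-entry $\theta_{d-i}$ and $(i,i-1)$-entry $1$, and $A^*$ by the upper bidiagonal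 matrix with $(i,i)$-entry $\theta^*_i$ and $(i-1,i)$-entry $\phi_i$ (all other entries $0$). It is known that $\{v_i\}_{i=0}^d$ and $\{v^*_i\}_{i=0}^d$ are bases of $V$ and that $\varepsilon^*\neq0$. The transition matrix from a basis $\{x_i\}_{i=0}^d$ to a basis $\{y_i\}_{i=0}^d$ is the matrix $T$ with $y_j=\sum_{i=0}^dT_{ij}x_i$ for $0\le j\le d$. Empty products equal $1$. *)

theory Defs
  imports "Jordan_Normal_Form.Matrix"
begin

text \<open>
  The vector space \<open>V\<close> is the whole type \<open>'b\<close>, with scalar multiplication \<open>scale\<close> over the
  field \<open>'a\<close>.  A sequence indexed by \<open>0, \<dots>, d\<close> is a function on \<open>nat\<close> whose values beyond
  \<open>d\<close> play no role.
\<close>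

definition is_basis ::
    "('a::field \<Rightarrow> 'b::ab_group_add \<Rightarrow> 'b) \<Rightarrow>
     nat \<Rightarrow> (nat \<Rightarrow> 'b) \<Rightarrow> bool" where
  "is_basis scale d w \<longleftrightarrow>
     inj_on w {0..d} \<and> \<not> module.dependent scale (w ` {0..d}) \<and>
     module.span scale (w ` {0..d}) = UNIV"

definition represents ::
    "('a::field \<Rightarrow> 'b::ab_group_add \<Rightarrow> 'b) \<Rightarrow>
     nat \<Rightarrow> 'a mat \<Rightarrow> (nat \<Rightarrow> 'b) \<Rightarrow> ('b \<Rightarrow> 'b) \<Rightarrow> bool" where
  "represents scale d M w B \<longleftrightarrow>
     M \<in> carrier_mat (d + 1) (d + 1) \<and>
     (\<forall>j\<le>d. B (w j) = (\<Sum>i = 0..d. scale (M $$ (i, j)) (w i)))"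

definition transition_mat ::
    "('a::field \<Rightarrow> 'b::ab_group_add \<Rightarrow> 'b) \<Rightarrow>
     nat \<Rightarrow> (nat \<Rightarrow> 'b) \<Rightarrow> (nat \<Rightarrow> 'b) \<Rightarrow> 'a mat \<Rightarrow> bool" where
  "transition_mat scale d x y T \<longleftrightarrow>
     is_basis scale d x \<and> is_basis scale d y \<and> T \<in> carrier_mat (d + 1) (d + 1) \<and>
     (\<forall>j\<le>d. y j = (\<Sum>i = 0..d. scale (T $$ (i, j)) (x i)))"

definition eigenspace ::
    "('a::field \<Rightarrow> 'b::ab_group_add \<Rightarrow> 'b) \<Rightarrow>
     ('b \<Rightarrow> 'b) \<Rightarrow> 'a \<Rightarrow> 'b set" where
  "eigenspace scale B \<theta> = {w. B w = scale \<theta> w}"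

definition eigenvalue_of ::
    "('a::field \<Rightarrow> 'b::ab_group_add \<Rightarrow> 'b) \<Rightarrow>
     ('b \<Rightarrow> 'b) \<Rightarrow> 'a \<Rightarrow> bool" where
  "eigenvalue_of scale B \<theta> \<longleftrightarrow> (\<exists>w. w \<noteq> 0 \<and> w \<in> eigenspace scale B \<theta>)"

definition diagonalizable ::
    "('a::field \<Rightarrow> 'b::ab_group_add \<Rightarrow> 'b) \<Rightarrow>
     ('b \<Rightarrow> 'b) \<Rightarrow> bool" where
  "diagonalizable scale B \<longleftrightarrow>
     (\<exists>S. \<not> module.dependent scale S \<and> module.span scale S = UNIV \<and>
        (\<forall>w\<in>S. \<exists>\<theta>. w \<in> eigenspace scale B \<theta>))"

definition multiplicity_free ::
    "('a::field \<Rightarrow> 'b::ab_group_add \<Rightarrow> 'b) \<Rightarrow>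
     ('b \<Rightarrow> 'b) \<Rightarrow> bool" where
  "multiplicity_free scale B \<longleftrightarrow>
     Vector_Spaces.linear scale scale B \<and> diagonalizable scale B \<and>
     (\<forall>\<theta>. eigenvalue_of scale B \<theta> \<longrightarrow> vector_space.dim scale (eigenspace scale B \<theta>) = 1)"

definition primitive_idempotent ::
    "('a::field \<Rightarrow> 'b::ab_group_add \<Rightarrow> 'b) \<Rightarrow>
     ('b \<Rightarrow> 'b) \<Rightarrow> 'a \<Rightarrow> ('b \<Rightarrow> 'b) \<Rightarrow> bool" where
  "primitive_idempotent scale B \<theta> E \<longleftrightarrow>
     eigenvalue_of scale B \<theta> \<and> Vector_Spaces.linear scale scale E \<and>
     (\<forall>w\<in>eigenspace scale B \<theta>. E w = w) \<and>
     (\<forall>\<mu>. eigenvalue_of scale B \<mu> \<and> \<mu> \<noteq> \<theta> \<longrightarrow> (\<forall>w\<in>eigenspace scale B \<mu>. E w = 0))"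

definition idempotent_ordering ::
    "('a::field \<Rightarrow> 'b::ab_group_add \<Rightarrow> 'b) \<Rightarrow>
     nat \<Rightarrow> ('b \<Rightarrow> 'b) \<Rightarrow> (nat \<Rightarrow> 'b \<Rightarrow> 'b) \<Rightarrow> bool" where
  "idempotent_ordering scale d B E \<longleftrightarrow>
     bij_betw E {0..d} {F. \<exists>\<theta>. primitive_idempotent scale B \<theta> F}"

definition eigenvalue_seq ::
    "('a::field \<Rightarrow> 'b::ab_group_add \<Rightarrow> 'b) \<Rightarrow>
     nat \<Rightarrow> ('b \<Rightarrow> 'b) \<Rightarrow> (nat \<Rightarrow> 'b \<Rightarrow> 'b) \<Rightarrow> (nat \<Rightarrow> 'a) \<Rightarrow> bool" where
  "eigenvalue_seq scale d B E \<theta> \<longleftrightarrow> (\<forall>i\<le>d. primitive_idempotent scale B (\<theta> i) (E i))"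

text \<open>Index differences are taken in \<open>int\<close>, since subtraction on \<open>nat\<close> truncates.\<close>

definition circular_hessenberg :: "nat \<Rightarrow> (nat \<Rightarrow> 'b::zero \<Rightarrow> 'b) \<Rightarrow> ('b \<Rightarrow> 'b) \<Rightarrow> bool" where
  "circular_hessenberg d E B \<longleftrightarrow>
     (\<forall>i\<le>d. \<forall>j\<le>d.
        (1 < int i - int j \<or> (1 < int j - int i \<and> int j - int i < int d)
           \<longrightarrow> E i \<circ> B \<circ> E j = (\<lambda>_. 0)) \<and>
        (int i - int j = 1 \<or> int j - int i = int d
           \<longrightarrow> E i \<circ> B \<circ> E j \<noteq> (\<lambda>_. 0)))"

definition CH_system ::
    "('a::field \<Rightarrow> 'b::ab_group_add \<Rightarrow> 'b) \<Rightarrow>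
     nat \<Rightarrow> ('b \<Rightarrow> 'b) \<Rightarrow> (nat \<Rightarrow> 'b \<Rightarrow> 'b) \<Rightarrow> ('b \<Rightarrow> 'b) \<Rightarrow> (nat \<Rightarrow> 'b \<Rightarrow> 'b) \<Rightarrow> bool" where
  "CH_system scale d A E As Es \<longleftrightarrow>
     multiplicity_free scale A \<and> multiplicity_free scale As \<and>
     idempotent_ordering scale d A E \<and> idempotent_ordering scale d As Es \<and>
     circular_hessenberg d E As \<and> circular_hessenberg d Es A"

definition split_seq ::
    "('a::field \<Rightarrow> 'b::ab_group_add \<Rightarrow> 'b) \<Rightarrow>
     nat \<Rightarrow> ('b \<Rightarrow> 'b) \<Rightarrow> ('b \<Rightarrow> 'b) \<Rightarrow> (nat \<Rightarrow> 'a) \<Rightarrow> (nat \<Rightarrow> 'a) \<Rightarrow> (nat \<Rightarrow> 'a) \<Rightarrow> bool" where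
  "split_seq scale d A As \<theta> \<theta>s \<phi> \<longleftrightarrow>
     (\<forall>i\<in>{1..d}. \<phi> i \<noteq> 0) \<and>
     (\<exists>w. is_basis scale d w \<and>
        represents scale d (mat (d + 1) (d + 1)
          (\<lambda>(i, j). if i = j then \<theta> (d - i) else if i = j + 1 then 1 else 0)) w A \<and>
        represents scale d (mat (d + 1) (d + 1)
          (\<lambda>(i, j). if i = j then \<theta>s i else if j = i + 1 then \<phi> j else 0)) w As)"

text \<open>
  \<open>shifted_chain scale d B \<theta> x i\<close> is
  \<open>(B - \<theta>\<^sub>d\<^sub>-\<^sub>i\<^sub>+\<^sub>1 I) \<cdots> (B - \<theta>\<^sub>d\<^sub>-\<^sub>1 I) (B - \<theta>\<^sub>d I) x\<close>, with \<open>i\<close> factors;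
  it is meaningful for \<open>i \<le> d\<close>.
\<close>

primrec shifted_chain ::
    "('a::field \<Rightarrow> 'b::ab_group_add \<Rightarrow> 'b) \<Rightarrow>
     nat \<Rightarrow> ('b \<Rightarrow> 'b) \<Rightarrow> (nat \<Rightarrow> 'a) \<Rightarrow> 'b \<Rightarrow> nat \<Rightarrow> 'b" where
  "shifted_chain scale d B \<theta> x 0 = x"
| "shifted_chain scale d B \<theta> x (Suc i) =
     B (shifted_chain scale d B \<theta> x i) - scale (\<theta> (d - i)) (shifted_chain scale d B \<theta> x i)"

end

theory Submission
  imports Defs
begin

text \<open>
  Let \<open>w\<close> be the basis defining the split sequence.  Then \<open>w\<^sub>0\<close> is an eigenvector of \<open>A\<^sup>*\<close> for
  \<open>\<theta>\<^sup>*\<^sub>0\<close> and \<open>w\<^sub>d\<close> is an eigenvector of \<open>A\<close> for \<open>\<theta>\<^sub>0\<close>, so \<open>u\<^sup>* = c w\<^sub>0\<close> and \<open>u = e w\<^sub>d\<close>.  Running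
  down the bidiagonal matrices gives \<open>v\<^sub>i = c w\<^sub>i\<close> and \<open>v\<^sup>*\<^sub>i = e \<phi>\<^sub>d \<cdots> \<phi>\<^sub>d\<^sub>-\<^sub>i\<^sub>+\<^sub>1 w\<^sub>d\<^sub>-\<^sub>i\<close>.  The ratio
  \<open>e / c\<close> comes from applying \<open>E\<^sup>*\<^sub>0\<close> to \<open>v\<^sup>*\<^sub>d = (A\<^sup>* - \<theta>\<^sup>*\<^sub>1) \<cdots> (A\<^sup>* - \<theta>\<^sup>*\<^sub>d) u\<close>: since
  \<open>E\<^sup>*\<^sub>0 A\<^sup>* = \<theta>\<^sup>*\<^sub>0 E\<^sup>*\<^sub>0\<close>, it equals \<open>\<epsilon>\<^sup>* (\<theta>\<^sup>*\<^sub>0 - \<theta>\<^sup>*\<^sub>1) \<cdots> (\<theta>\<^sup>*\<^sub>0 - \<theta>\<^sup>*\<^sub>d) u\<^sup>*\<close> on the one hand and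
  \<open>e \<phi>\<^sub>1 \<cdots> \<phi>\<^sub>d w\<^sub>0\<close> on the other.
\<close>

context vector_space
begin

text \<open>Each \<open>w j\<close> is a multiple of some \<open>y i\<close>, so \<open>y\<close>
  spans; a spanning family of \<open>d + 1\<close> vectors in dimension \<open>d + 1\<close> is
  injective and independent. Both bases of the theorem arise from \<open>w\<close> by reversing the
  order and rescaling.\<close>

lemma is_basis_scaled_permuted:
  assumes w: "is_basis scale d w"
    and perm: "\<pi> ` {0..d} = {0..d}"
    and c: "\<And>i. i \<le> d \<Longrightarrow> c i \<noteq> 0"
    and y: "\<And>i. i \<le> d \<Longrightarrow> y i = scale (c i) (w (\<pi> i))"
  shows "is_basis scale d y"
proof -
  have ind: "independent (w ` {0..d})" and sp: "span (w ` {0..d}) = UNIV"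
    and inj: "inj_on w {0..d}"
    using w by (auto simp: is_basis_def)
  interpret finite_dimensional_vector_space scale "w ` {0..d}"
    using ind sp by unfold_locales auto
  have dim: "dim UNIV = d + 1"
    by (simp add: card_image[OF inj])
  have "w j \<in> span (y ` {0..d})" if "j \<le> d" for j
  proof -
    have "j \<in> \<pi> ` {0..d}"
      using that perm by simp
    then obtain i where i: "i \<le> d" "\<pi> i = j"
      by auto
    have "w j = scale (inverse (c i)) (y i)"
      using i c[of i] by (simp add: y)
    then show ?thesis
      using i by (simp add: span_scale span_base)
  qed
  then have "span (w ` {0..d}) \<subseteq> span (y ` {0..d})"
    by (intro span_minimal) auto
  then have spy: "span (y ` {0..d}) = UNIV"
    using sp by auto
  have "d + 1 \<le> card (y ` {0..d})"
    using dim_le_card[of UNIV "y ` {0..d}"] spy dim by simp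
  then have cardy: "card (y ` {0..d}) = card {0..d}"
    using card_image_le[of "{0..d}" y] by simp
  have "independent (y ` {0..d})"
    by (rule card_le_dim_spanning[of _ UNIV]) (use spy dim cardy in auto)
  then show ?thesis
    using spy cardy by (simp add: is_basis_def eq_card_imp_inj_on)
qed

lemma is_basis_nonzero:
  assumes "is_basis scale d w" and "i \<le> d"
  shows "w i \<noteq> 0"
  using assms dependent_zero[of "w ` {0..d}"] by (force simp: is_basis_def)

lemma transition_mat_diagI:
  assumes "is_basis scale d x" and "is_basis scale d y"
    and "\<And>j. j \<le> d \<Longrightarrow> y j = scale (f j) (x j)"
  shows "transition_mat scale d x y (mat_diag (d + 1) f)"
proof -
  have "(\<Sum>i = 0..d. scale (mat_diag (d + 1) f $$ (i, j)) (x i)) = scale (f j) (x j)"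
    if "j \<le> d" for j
  proof -
    have "(\<Sum>i = 0..d. scale (mat_diag (d + 1) f $$ (i, j)) (x i)) =
        (\<Sum>i = 0..d. if i = j then scale (f j) (x j) else 0)"
      using that by (intro sum.cong) (auto simp: mat_diag_def)
    then show ?thesis
      using that by simp
  qed
  then show ?thesis
    using assms by (simp add: transition_mat_def)
qed

lemma represents_lower_bidiagonal:
  assumes "represents scale d (mat (d + 1) (d + 1)
      (\<lambda>(i, j). if i = j then \<theta> i else if i = j + 1 then 1 else 0)) w B"
    and "j \<le> d"
  shows "B (w j) = scale (\<theta> j) (w j) + (if j < d then w (Suc j) else 0)"
proof -
  have "B (w j) = (\<Sum>i = 0..d. scale (if i = j then \<theta> i else if i = j + 1 then 1 else 0) (w i))"
    using assms by (simp add: represents_def)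
  also have "\<dots> = (\<Sum>i = 0..d. (if i = j then scale (\<theta> j) (w j) else 0)
      + (if i = Suc j then w (Suc j) else 0))"
    by (intro sum.cong) auto
  also have "\<dots> = scale (\<theta> j) (w j) + (if j < d then w (Suc j) else 0)"
    using assms(2) by (simp add: sum.distrib Suc_le_eq)
  finally show ?thesis .
qed

lemma represents_upper_bidiagonal:
  assumes "represents scale d (mat (d + 1) (d + 1)
      (\<lambda>(i, j). if i = j then \<theta> i else if j = i + 1 then \<phi> j else 0)) w B"
    and "j \<le> d"
  shows "B (w j) = scale (\<theta> j) (w j) + (if 0 < j then scale (\<phi> j) (w (j - 1)) else 0)"
proof -
  have "B (w j) = (\<Sum>i = 0..d. scale (if i = j then \<theta> i else if j = i + 1 then \<phi> j else 0) (w i))"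
    using assms by (simp add: represents_def)
  \<comment> \<open>For \<open>j = 0\<close> the truncated \<open>j - 1\<close> is \<open>0\<close>,
    a valid index; the inner test \<open>0 < j\<close> removes this spurious term.\<close>
  also have "\<dots> = (\<Sum>i = 0..d. (if i = j then scale (\<theta> j) (w j) else 0)
      + (if i = j - 1 then (if 0 < j then scale (\<phi> j) (w (j - 1)) else 0) else 0))"
    by (intro sum.cong) auto
  also have "\<dots> = scale (\<theta> j) (w j) + (if 0 < j then scale (\<phi> j) (w (j - 1)) else 0)"
    using assms(2) by (cases j) (simp_all add: sum.distrib)
  finally show ?thesis .
qed

text \<open>A one-dimensional eigenspace lies in the span of a single vector \<open>b\<close>, and
  \<open>x\<close> and \<open>y\<close> are both nonzero multiples of \<open>b\<close>.\<close>

lemma multiplicity_free_eigenspace_scale: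
  assumes mf: "multiplicity_free scale B"
    and x: "x \<in> eigenspace scale B \<theta>" "x \<noteq> 0"
    and y: "y \<in> eigenspace scale B \<theta>" "y \<noteq> 0"
  obtains c where "c \<noteq> 0" and "y = scale c x"
proof -
  have "eigenvalue_of scale B \<theta>"
    using x by (auto simp: eigenvalue_of_def)
  then have "dim (eigenspace scale B \<theta>) = 1"
    using mf by (simp add: multiplicity_free_def)
  moreover obtain S where "eigenspace scale B \<theta> \<subseteq> span S" "card S = dim (eigenspace scale B \<theta>)"
    by (rule basis_exists)
  ultimately obtain b where "eigenspace scale B \<theta> \<subseteq> span {b}"
    by (auto simp: card_1_singleton_iff)
  then obtain k l where k: "x = scale k b" and l: "y = scale l b"
    using x(1) y(1) by (metis rangeE span_singleton subsetD)
  show thesis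
  proof
    show "l / k \<noteq> 0" "y = scale (l / k) x"
      using k l x y by auto
  qed
qed

text \<open>On a basis of eigenvectors of \<open>B\<close>, \<open>E\<close> is the identity or zero
  according to the eigenvalue, so both identities hold there and extend linearly.\<close>

lemma primitive_idempotent_eigenvector:
  assumes mf: "multiplicity_free scale B"
    and E: "primitive_idempotent scale B \<theta> E"
  shows "B (E x) = scale \<theta> (E x)" and "E (B x) = scale \<theta> (E x)"
proof -
  have linB: "Vector_Spaces.linear scale scale B" and linE: "Vector_Spaces.linear scale scale E"
    using assms by (auto simp: multiplicity_free_def primitive_idempotent_def)
  interpret B: Vector_Spaces.linear scale scale B by (fact linB)
  interpret E: Vector_Spaces.linear scale scale E by (fact linE)
  obtain S where ind: "independent S" and sp: "span S = UNIV"
    and ev: "\<And>w. w \<in> S \<Longrightarrow> \<exists>\<mu>. w \<in> eigenspace scale B \<mu>"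
    using mf by (auto simp: multiplicity_free_def diagonalizable_def)
  have S: "B (E w) = scale \<theta> (E w) \<and> E (B w) = scale \<theta> (E w)" if "w \<in> S" for w
  proof -
    obtain \<mu> where \<mu>: "B w = scale \<mu> w"
      using ev[OF \<open>w \<in> S\<close>] by (auto simp: eigenspace_def)
    have "w \<noteq> 0"
      using ind \<open>w \<in> S\<close> dependent_zero by blast
    then have "eigenvalue_of scale B \<mu>"
      using \<mu> by (auto simp: eigenvalue_of_def eigenspace_def)
    then have "E w = (if \<mu> = \<theta> then w else 0)"
      using E \<mu> by (auto simp: primitive_idempotent_def eigenspace_def)
    then show ?thesis
      using \<mu> by (simp add: E.scale B.zero)
  qed
  have "B (E x) = scale \<theta> (E x) \<and> E (B x) = scale \<theta> (E x)"
    using UNIV_I[of x, folded sp]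
  proof (induction rule: span_induct_alt)
    case base
    show ?case
      by (simp add: B.zero E.zero)
  next
    case (step c w y)
    then show ?case
      using S[of w] by (simp add: B.add B.scale E.add E.scale algebra_simps)
  qed
  then show "B (E x) = scale \<theta> (E x)" and "E (B x) = scale \<theta> (E x)"
    by auto
qed

text \<open>The shift applied to \<open>w i\<close> is exactly its diagonal entry
  \<open>\<theta> (d - i)\<close>, so only \<open>w (Suc i)\<close> survives.\<close>

lemma shifted_chain_lower_bidiagonal:
  assumes lin: "Vector_Spaces.linear scale scale B"
    and B: "\<And>j. j < d \<Longrightarrow> B (w j) = scale (\<theta> (d - j)) (w j) + w (Suc j)"
    and "i \<le> d"
  shows "shifted_chain scale d B \<theta> (scale c (w 0)) i = scale c (w i)"
  using \<open>i \<le> d\<close>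
proof (induction i)
  case (Suc i)
  interpret B: Vector_Spaces.linear scale scale B by (fact lin)
  show ?case
    using Suc by (simp add: B.scale B algebra_simps)
qed simp

text \<open>Starting from the far end \<open>w d\<close>, each shift again cancels the diagonal
  entry; moving from index \<open>d - i\<close> to the one below collects the factor
  \<open>\<phi> (d - i)\<close>.\<close>

lemma shifted_chain_upper_bidiagonal:
  assumes lin: "Vector_Spaces.linear scale scale B"
    and B: "\<And>j. 0 < j \<Longrightarrow> j \<le> d \<Longrightarrow> B (w j) = scale (\<theta> j) (w j) + scale (\<phi> j) (w (j - 1))"
    and "i \<le> d"
  shows "shifted_chain scale d B \<theta> (scale c (w d)) i = scale (c * (\<Prod>k = d - i + 1..d. \<phi> k)) (w (d - i))"
  using \<open>i \<le> d\<close>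
proof (induction i)
  case (Suc i)
  interpret B: Vector_Spaces.linear scale scale B by (fact lin)
  \<comment> \<open>Because \<open>Suc i \<le> d\<close>, nothing truncates and the lower bound on
    the left is \<open>d - i\<close>.\<close>
  have "{d - Suc i + 1..d} = insert (d - i) {d - i + 1..d}"
    using Suc.prems by auto
  then have "(\<Prod>k = d - Suc i + 1..d. \<phi> k) = \<phi> (d - i) * (\<Prod>k = d - i + 1..d. \<phi> k)"
    by simp
  then show ?case
    using Suc by (simp add: B.scale B algebra_simps)
qed simp

text \<open>Under \<open>E\<close>, the operator \<open>B\<close> acts as the scalar
  \<open>\<mu>\<close>, so each factor of the chain contributes
  \<open>\<mu> - \<theta> k\<close>.\<close>

lemma functional_shifted_chain:
  assumes lin: "Vector_Spaces.linear scale scale E"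
    and E: "\<And>x. E (B x) = scale \<mu> (E x)"
    and "i \<le> d"
  shows "E (shifted_chain scale d B \<theta> x i) = scale (\<Prod>k = d - i + 1..d. \<mu> - \<theta> k) (E x)"
  using \<open>i \<le> d\<close>
proof (induction i)
  case (Suc i)
  interpret E: Vector_Spaces.linear scale scale E by (fact lin)
  have "{d - Suc i + 1..d} = insert (d - i) {d - i + 1..d}"
    using Suc.prems by auto
  then have "(\<Prod>k = d - Suc i + 1..d. \<mu> - \<theta> k) = (\<mu> - \<theta> (d - i)) * (\<Prod>k = d - i + 1..d. \<mu> - \<theta> k)"
    by simp
  then show ?case
    using Suc by (simp add: E.diff E.scale E left_diff_distrib scale_left_diff_distrib del: Suc_diff_Suc)
qed simp

end

theorem lemma6p4:
  fixes scale :: "'a::field \<Rightarrow> 'b::ab_group_add \<Rightarrow> 'b"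
    and d :: nat
    and A As :: "'b \<Rightarrow> 'b"
    and E Es :: "nat \<Rightarrow> 'b \<Rightarrow> 'b"
    and \<theta> \<theta>s \<phi> :: "nat \<Rightarrow> 'a"
    and u us :: 'b
    and \<epsilon>s :: 'a
    and v vs :: "nat \<Rightarrow> 'b"
  assumes "vector_space scale"
    and "d \<ge> 3"
    and "vector_space.dim scale (UNIV :: 'b set) = d + 1"
    and "CH_system scale d A E As Es"
    and "eigenvalue_seq scale d A E \<theta>"
    and "eigenvalue_seq scale d As Es \<theta>s"
    and "split_seq scale d A As \<theta> \<theta>s \<phi>"
    and "us \<in> range (Es 0)" and "us \<noteq> 0"
    and "u \<in> range (E 0)" and "u \<noteq> 0"
    and "Es 0 u = scale \<epsilon>s us"
    and "\<And>i. i \<le> d \<Longrightarrow> v i = shifted_chain scale d A \<theta> us i"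
    and "\<And>i. i \<le> d \<Longrightarrow> vs i = shifted_chain scale d As \<theta>s u i"
  shows "transition_mat scale d (\<lambda>i. v (d - i)) vs
           (mat_diag (d + 1) (\<lambda>i.
              \<epsilon>s * (\<Prod>k = 1..d. \<theta>s 0 - \<theta>s k) / (\<Prod>k = 1..d - i. \<phi> k)))
       \<and> transition_mat scale d vs (\<lambda>i. v (d - i))
           (mat_diag (d + 1) (\<lambda>i.
              (\<Prod>k = 1..d - i. \<phi> k) / (\<epsilon>s * (\<Prod>k = 1..d. \<theta>s 0 - \<theta>s k))))"
proof -
  interpret vector_space scale by fact
  have mfA: "multiplicity_free scale A" and mfAs: "multiplicity_free scale As"
    using assms(4) by (auto simp: CH_system_def)
  have linA: "Vector_Spaces.linear scale scale A" and linAs: "Vector_Spaces.linear scale scale As"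
    using mfA mfAs by (auto simp: multiplicity_free_def)
  have E0: "primitive_idempotent scale A (\<theta> 0) (E 0)"
    and Es0: "primitive_idempotent scale As (\<theta>s 0) (Es 0)"
    using assms(5,6) by (auto simp: eigenvalue_seq_def)
  have linEs: "Vector_Spaces.linear scale scale (Es 0)"
    using Es0 by (simp add: primitive_idempotent_def)
  obtain w where w: "is_basis scale d w"
    and repA: "represents scale d (mat (d + 1) (d + 1)
      (\<lambda>(i, j). if i = j then \<theta> (d - i) else if i = j + 1 then 1 else 0)) w A"
    and repAs: "represents scale d (mat (d + 1) (d + 1)
      (\<lambda>(i, j). if i = j then \<theta>s i else if j = i + 1 then \<phi> j else 0)) w As"
    and \<phi>: "\<And>k. k \<in> {1..d} \<Longrightarrow> \<phi> k \<noteq> 0"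
    using assms(7) unfolding split_seq_def by blast
  note Aw = represents_lower_bidiagonal[OF repA] and Asw = represents_upper_bidiagonal[OF repAs]
  have us: "us \<in> eigenspace scale As (\<theta>s 0)" and u: "u \<in> eigenspace scale A (\<theta> 0)"
    using assms(8,10) primitive_idempotent_eigenvector(1)[OF mfA E0]
      primitive_idempotent_eigenvector(1)[OF mfAs Es0]
    by (auto simp: eigenspace_def)
  have w0: "w 0 \<in> eigenspace scale As (\<theta>s 0)" and wd: "w d \<in> eigenspace scale A (\<theta> 0)"
    using Aw[of d] Asw[of 0] by (auto simp: eigenspace_def)
  obtain c where c: "c \<noteq> 0" "us = scale c (w 0)"
    using multiplicity_free_eigenspace_scale[OF mfAs w0 is_basis_nonzero[OF w] us] assms(9) by auto
  obtain e where e: "e \<noteq> 0" "u = scale e (w d)"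
    using multiplicity_free_eigenspace_scale[OF mfA wd is_basis_nonzero[OF w] u] assms(11) by auto
  have v: "v i = scale c (w i)" if "i \<le> d" for i
    using shifted_chain_lower_bidiagonal[OF linA _ that, of w \<theta> c] that
    by (simp add: assms(13) c Aw)
  \<comment> \<open>\<open>P i\<close> multiplies the first \<open>i\<close> split scalars and
    \<open>Q i\<close> the last \<open>i\<close>, those collected by the chain from
    \<open>w d\<close>; \<open>K\<close> is the numerator of the claimed entries.\<close>
  define P where "P i = (\<Prod>k = 1..i. \<phi> k)" for i
  define Q where "Q i = (\<Prod>k = d - i + 1..d. \<phi> k)" for i
  define K where "K = \<epsilon>s * (\<Prod>k = 1..d. \<theta>s 0 - \<theta>s k)"
  have vs: "vs i = scale (e * Q i) (w (d - i))" if "i \<le> d" for i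
    using shifted_chain_upper_bidiagonal[OF linAs _ that, of w \<theta>s \<phi> e] that
    by (simp add: assms(14) e Asw Q_def)
  have P: "P i \<noteq> 0" if "i \<le> d" for i
    using \<phi> that by (auto simp: P_def)
  have Q: "Q i \<noteq> 0" for i
    using \<phi> by (auto simp: Q_def)
  have PQ: "P d = P (d - i) * Q i" if "i \<le> d" for i
    using prod.ub_add_nat[of 1 "d - i" \<phi> i] that by (simp add: P_def Q_def)
  have "scale (e * P d) (w 0) = scale (K * c) (w 0)"
  proof -
    \<comment> \<open>At \<open>i = d\<close> the lower bound \<open>d - i + 1\<close> is
      \<open>1\<close>, so the possibly vanishing factor for \<open>\<theta>s 0\<close> itself never
      occurs.\<close>
    have "Es 0 (vs d) = scale (\<Prod>k = 1..d. \<theta>s 0 - \<theta>s k) (Es 0 u)"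
      using functional_shifted_chain[OF linEs primitive_idempotent_eigenvector(2)[OF mfAs Es0],
          where i = d]
      by (simp add: assms(14))
    also have "\<dots> = scale (K * c) (w 0)"
      by (simp add: assms(12) c K_def mult_ac)
    finally have *: "Es 0 (vs d) = scale (K * c) (w 0)" .
    have "Es 0 (w 0) = w 0"
      using w0 Es0 by (simp add: primitive_idempotent_def)
    then have "Es 0 (vs d) = scale (e * P d) (w 0)"
      using PQ[of d] module_hom.scale[OF linEs[folded module_hom_iff_linear]]
      by (simp add: vs P_def)
    with * show ?thesis by simp
  qed
  then have eP: "e * P d = K * c"
    using is_basis_nonzero[OF w, of 0] by simp
  \<comment> \<open>This yields in particular that \<open>\<epsilon>s\<close> is nonzero, and it
    permits division by \<open>K\<close> in the second transition matrix.\<close>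
  then have K: "K \<noteq> 0"
    using c e P[of d] by auto
  have perm: "(\<lambda>i. d - i) ` {0..d} = {0..d}"
    by (rule endo_inj_surj) (auto simp: inj_on_def)
  have bv: "is_basis scale d (\<lambda>i. v (d - i))"
    by (rule is_basis_scaled_permuted[OF w perm, of "\<lambda>_. c"]) (use c v in auto)
  have bvs: "is_basis scale d vs"
    by (rule is_basis_scaled_permuted[OF w perm, of "\<lambda>i. e * Q i"]) (use e Q vs in auto)
  \<comment> \<open>Since \<open>vs i\<close> and \<open>v (d - i)\<close> are the multiples
    \<open>e * Q i\<close> and \<open>c\<close> of the same \<open>w (d - i)\<close>, this
    determines their ratio as \<open>K / P (d - i)\<close>.\<close>
  have rel: "e * Q i * P (d - i) = K * c" if "i \<le> d" for i
    using eP PQ[OF that] by (simp add: mult_ac)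
  have "vs i = scale (K / P (d - i)) (v (d - i))" if "i \<le> d" for i
    using rel[OF that] P[of "d - i"] that by (simp add: vs v field_simps)
  moreover have "v (d - i) = scale (P (d - i) / K) (vs i)" if "i \<le> d" for i
    using rel[OF that] K that by (simp add: vs v field_simps)
  ultimately have "transition_mat scale d (\<lambda>i. v (d - i)) vs (mat_diag (d + 1) (\<lambda>i. K / P (d - i)))
      \<and> transition_mat scale d vs (\<lambda>i. v (d - i)) (mat_diag (d + 1) (\<lambda>i. P (d - i) / K))"
    by (intro conjI transition_mat_diagI bv bvs)
  then show ?thesis
    by (simp only: P_def K_def)
qed

end
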